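(* For every $\varepsilon>0$ there is a constant $c_\varepsilon$ (depending only on $\varepsilon$, not on the instance) and an online algorithm with advice for the proportional removable knapsack problem \textsc{RemKnap} that reads at most $c_\varepsilon$ advice bits on every instance and is strictly $(1+\varepsilon)$-competitive.
   Context: \textsc{RemKnap} (proportional removable knapsack) is the following online maximization problem. An instance is a sequence of items $1,\dots,n$ with sizes $s_1,\dots,s_n\in\mathbb{R}_{>0}$; the knapsack has capacity $1$. For a set $A$ of items, $s(A)=\sum_{i\in A}s_i$. The items are revealed one by one; the algorithm starts with the empty packing $A_0=\emptyset$, and when item $i$ is revealed (and only then does it learn $s_i$) it must choose a new packing $A_i\subseteq A_{i-1}\cup\{i\}$ with $s(A_i)\le 1$. Thus it may remove any previously packed items and may pack the new item, but a removed or rejected item can never be packed again. The algorithm learns $n$ only after choosing $A_n$. The gain is $\mathrm{ALG}(I)=s(A_n)$; $\mathrm{OPT}(I)$ is the maximum of $s(A)$ over all subsets $A$ of the items with $s(A)\le1$. In the advice model, an omniscient oracle that knows the whole instance writes a binary advice string that the algorithm may read; the number of bits read is counted. An algorithm is strictly $\rho$-competitive if $\mathrm{OPT}(I)/\mathrm{ALG}(I)\le\rho$ for every instance $I$. *)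

theory Defs
  imports Complex_Main
begin

text \<open>
  An instance is the list of its item sizes, so items are numbered from \<open>0\<close>: item \<open>i\<close> has size
  \<open>xs ! i\<close>, and \<open>take i xs\<close> is what has been revealed after \<open>i\<close> rounds.  Items of size greater
  than the capacity \<open>1\<close> are allowed.
\<close>

definition remknap_instance :: "real list \<Rightarrow> bool" where
  "remknap_instance xs \<longleftrightarrow> (\<forall>x\<in>set xs. 0 < x)"

definition total_size :: "real list \<Rightarrow> nat set \<Rightarrow> real" where
  "total_size xs A = (\<Sum>i\<in>A. xs ! i)"

definition OPT :: "real list \<Rightarrow> real" where
  "OPT xs = Max {total_size xs A | A. A \<subseteq> {..<length xs} \<and> total_size xs A \<le> 1}"

text \<open>
  Adaptive sequential access to the advice: before settling on a result, a computation may read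
  further bits one at a time, and may let everything it does next depend on the bits obtained.
  As datatype values are well-founded, it reads only finitely many bits on each tape.
\<close>

datatype 'a advised = Return 'a | Read_Bit "bool \<Rightarrow> 'a advised"

type_synonym tape = "nat \<Rightarrow> bool"

text \<open>
  \<open>exec m \<phi> p\<close> runs \<open>m\<close> with the read head at position \<open>p\<close> of the tape \<open>\<phi>\<close>; it yields the result
  and the new position of the head.
\<close>

primrec exec :: "'a advised \<Rightarrow> tape \<Rightarrow> nat \<Rightarrow> 'a \<times> nat" where
  "exec (Return a) \<phi> p = (a, p)"
| "exec (Read_Bit f) \<phi> p = exec (f (\<phi> p)) \<phi> (Suc p)"

text \<open>
  In each round, a deterministic algorithm knows the sizes revealed so far and the advice bits
  read in earlier rounds (these determine its previous packings); it may read more bits and then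
  chooses the new packing.  It is told neither the number of items nor where the useful part of
  the tape ends.
\<close>

type_synonym advice_algorithm = "real list \<Rightarrow> bool list \<Rightarrow> nat set advised"

text \<open>\<open>run alg \<phi> xs i\<close> is the packing after \<open>i\<close> rounds with the number of bits read by then.\<close>

primrec run :: "advice_algorithm \<Rightarrow> tape \<Rightarrow> real list \<Rightarrow> nat \<Rightarrow> nat set \<times> nat" where
  "run alg \<phi> xs 0 = ({}, 0)"
| "run alg \<phi> xs (Suc i) =
     (let p = snd (run alg \<phi> xs i)
      in exec (alg (take (Suc i) xs) (map \<phi> [0..<p])) \<phi> p)"

definition packing :: "advice_algorithm \<Rightarrow> tape \<Rightarrow> real list \<Rightarrow> nat \<Rightarrow> nat set" where
  "packing alg \<phi> xs i = fst (run alg \<phi> xs i)"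

definition bits_read :: "advice_algorithm \<Rightarrow> tape \<Rightarrow> real list \<Rightarrow> nat" where
  "bits_read alg \<phi> xs = snd (run alg \<phi> xs (length xs))"

definition ALG :: "advice_algorithm \<Rightarrow> tape \<Rightarrow> real list \<Rightarrow> real" where
  "ALG alg \<phi> xs = total_size xs (packing alg \<phi> xs (length xs))"

text \<open>The rules of the game have to be obeyed whatever is written on the tape.\<close>

definition remknap_algorithm :: "advice_algorithm \<Rightarrow> bool" where
  "remknap_algorithm alg \<longleftrightarrow>
     (\<forall>xs \<phi>. remknap_instance xs \<longrightarrow>
        (\<forall>i<length xs.
           packing alg \<phi> xs (Suc i) \<subseteq> packing alg \<phi> xs i \<union> {i} \<and>
           total_size xs (packing alg \<phi> xs (Suc i)) \<le> 1))"

text \<open>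
  The oracle maps an instance to a tape.  The condition on the ratio of \<open>OPT\<close> to \<open>ALG\<close> is stated
  without division: as \<open>x / 0 = 0\<close>, a quotient would wrongly admit \<open>ALG = 0 < OPT\<close>.  Where
  \<open>OPT = ALG = 0\<close> (no item fits), the condition holds.
\<close>

definition strictly_competitive :: "real \<Rightarrow> advice_algorithm \<Rightarrow> (real list \<Rightarrow> tape) \<Rightarrow> bool" where
  "strictly_competitive \<rho> alg oracle_tape \<longleftrightarrow>
     (\<forall>xs. remknap_instance xs \<longrightarrow> OPT xs \<le> \<rho> * ALG alg (oracle_tape xs) xs)"

end

theory Submission
  imports Defs "HOL-Library.Multiset"
begin

text \<open>
  Call items of size at most \<open>1 / q\<close> small, and divide the large ones into classes of width
  \<open>1 / q\<^sup>2\<close>.  An optimal packing has at most \<open>q\<close> large items, so replacing them by equally many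
  smallest items of the same classes loses at most \<open>1 / q\<close>.  The advice is the list of the classes
  of these replacements in order of arrival.  Giving priority to earlier slots ensures that a
  replacement is never discarded once it has arrived.  The capacity not reserved for the listed
  classes is filled greedily with small items, for a total loss of at most \<open>3 / q\<close>.  If the optimum
  is below \<open>1 / 2\<close>, where an additive loss is not affordable, packing greedily is optimal.
\<close>

section \<open>Encoding a choice among finitely many strategies in constant advice\<close>

primrec read_bits :: "nat \<Rightarrow> bool list \<Rightarrow> (bool list \<Rightarrow> 'a) \<Rightarrow> 'a advised" where
  "read_bits 0 bs f = Return (f bs)"
| "read_bits (Suc n) bs f = Read_Bit (\<lambda>b. read_bits n (bs @ [b]) f)"

lemma exec_read_bits:
  "exec (read_bits n (map \<phi> [0..<p]) f) \<phi> p = (f (map \<phi> [0..<p + n]), p + n)"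
proof (induction n arbitrary: p)
  case (Suc n)
  have "map \<phi> [0..<p] @ [\<phi> p] = map \<phi> [0..<Suc p]" by simp
  then show ?case using Suc[of "Suc p"] by (simp del: upt_Suc)
qed simp

text \<open>The oracle only has to name a good \<open>c \<in> K\<close>. Its index is written in
  unary on \<open>card K\<close> bits, all read in the first round. A strategy is given as a
  function of the revealed prefix, so after \<open>i\<close> rounds the packing is simply
  \<open>P c (take i xs)\<close>.\<close>

lemma competitive_of_finitely_many_strategies:
  fixes P :: "'c \<Rightarrow> real list \<Rightarrow> nat set"
  assumes fin: "finite K" and ne: "K \<noteq> {}"
    and nil: "\<And>c. P c [] = {}"
    and step: "\<And>c xs i. c \<in> K \<Longrightarrow> i < length xs \<Longrightarrow>
                 P c (take (Suc i) xs) \<subseteq> P c (take i xs) \<union> {i}"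
    and fits: "\<And>c xs. c \<in> K \<Longrightarrow> total_size xs (P c xs) \<le> 1"
    and sub: "\<And>c xs. P c xs \<subseteq> {..<length xs}"
    and good: "\<And>xs. remknap_instance xs \<Longrightarrow> \<exists>c\<in>K. OPT xs \<le> \<rho> * total_size xs (P c xs)"
  shows "\<exists>(c :: nat) (alg :: advice_algorithm) (oracle_tape :: real list \<Rightarrow> tape).
           remknap_algorithm alg \<and>
           (\<forall>xs. remknap_instance xs \<longrightarrow> bits_read alg (oracle_tape xs) xs \<le> c) \<and>
           strictly_competitive \<rho> alg oracle_tape"
proof -
  define M where "M = card K"
  have M: "M > 0" using fin ne by (simp add: M_def card_gt_0_iff)
  obtain h where h: "bij_betw h {0..<M} K" using ex_bij_betw_nat_finite[OF fin] M_def by auto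
  \<comment> \<open>The index is the number of \<open>True\<close> bits. Reducing it modulo
    \<open>M\<close> makes every tape decode to a member of \<open>K\<close>, as the rules must be
    obeyed under arbitrary advice.\<close>
  define decode where "decode bs = h (length (filter (\<lambda>b. b) bs) mod M)" for bs :: "bool list"
  have decode: "decode bs \<in> K" for bs
    using h M by (auto simp: decode_def bij_betw_def)
  \<comment> \<open>The number of bits still missing is \<open>M\<close> in the first round and
    \<open>0\<close> afterwards, so later rounds decode the same strategy without further
    reading.\<close>
  define alg :: advice_algorithm where
    "alg xs bs = read_bits (M - length bs) bs (\<lambda>bs. P (decode bs) xs)" for xs bs
  define dec where "dec \<phi> = decode (map \<phi> [0..<M])" for \<phi> :: tape
  have run_Suc: "run alg \<phi> xs (Suc i) = (P (dec \<phi>) (take (Suc i) xs), M)" for \<phi> xs i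
  proof -
    have eq: "exec (alg ys (map \<phi> [0..<p])) \<phi> p = (P (dec \<phi>) ys, M)" if "p \<le> M" for p ys
      using that by (simp add: alg_def exec_read_bits dec_def)
    show ?thesis
      using eq[of 0] by (induction i) (simp_all add: eq Let_def del: upt_Suc)
  qed
  have pack: "packing alg \<phi> xs i = P (dec \<phi>) (take i xs)" for \<phi> xs i
    by (cases i) (simp_all add: packing_def run_Suc nil del: run.simps(2))
  have bits: "bits_read alg \<phi> xs \<le> M" for \<phi> xs
    by (cases "length xs") (simp_all add: bits_read_def run_Suc del: run.simps(2))
  have "remknap_algorithm alg"
    unfolding remknap_algorithm_def pack
  proof (intro allI impI conjI)
    fix xs :: "real list" and \<phi> i
    assume i: "i < length xs"
    show "P (dec \<phi>) (take (Suc i) xs) \<subseteq> P (dec \<phi>) (take i xs) \<union> {i}"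
      using step i decode by (simp add: dec_def)
    have "total_size xs (P (dec \<phi>) (take (Suc i) xs))
        = total_size (take (Suc i) xs) (P (dec \<phi>) (take (Suc i) xs))"
      unfolding total_size_def using sub[of "dec \<phi>" "take (Suc i) xs"] by (intro sum.cong) auto
    also have "\<dots> \<le> 1" using fits decode by (simp add: dec_def)
    finally show "total_size xs (P (dec \<phi>) (take (Suc i) xs)) \<le> 1" .
  qed
  moreover have "\<exists>\<phi>. remknap_instance xs \<longrightarrow> OPT xs \<le> \<rho> * ALG alg \<phi> xs" for xs
  proof (cases "remknap_instance xs")
    case True
    then obtain c where c: "c \<in> K" "OPT xs \<le> \<rho> * total_size xs (P c xs)" using good by blast
    obtain k where k: "k < M" "h k = c" using h c by (auto simp: bij_betw_def)
    define \<phi> :: tape where "\<phi> j = (j < k)" for j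
    have "length (filter (\<lambda>b. b) (map \<phi> [0..<M])) = card (set (filter (\<lambda>j. j < k) [0..<M]))"
      by (subst distinct_card) (simp_all add: filter_map o_def \<phi>_def)
    also have "set (filter (\<lambda>j. j < k) [0..<M]) = {..<k}" using k by auto
    finally have "length (filter (\<lambda>b. b) (map \<phi> [0..<M])) = k" by simp
    then have "dec \<phi> = c" using k by (simp only: dec_def decode_def mod_less)
    then show ?thesis using c by (auto simp: ALG_def pack)
  qed auto
  then obtain adv where
    "\<And>xs. remknap_instance xs \<longrightarrow> OPT xs \<le> \<rho> * ALG alg (adv xs) xs" by metis
  then have "strictly_competitive \<rho> alg adv" by (auto simp: strictly_competitive_def)
  ultimately show ?thesis using bits by blast
qed

section \<open>Optimal packings and exchange within size classes\<close>

lemma total_size_empty [simp]: "total_size xs {} = 0"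
  by (simp add: total_size_def)

lemma OPT_attained:
  obtains A where "A \<subseteq> {..<length xs}" "total_size xs A \<le> 1" "OPT xs = total_size xs A"
    "\<And>B. B \<subseteq> {..<length xs} \<Longrightarrow> total_size xs B \<le> 1 \<Longrightarrow> total_size xs B \<le> OPT xs"
proof -
  let ?V = "{total_size xs A | A. A \<subseteq> {..<length xs} \<and> total_size xs A \<le> 1}"
  have "?V \<subseteq> total_size xs ` Pow {..<length xs}" by auto
  then have fin: "finite ?V" using finite_subset by blast
  have "total_size xs {} \<in> ?V" by (force simp: total_size_def)
  then have "Max ?V \<in> ?V" using Max_in[OF fin] by blast
  then obtain A where "A \<subseteq> {..<length xs}" "total_size xs A \<le> 1" "OPT xs = total_size xs A"
    by (auto simp: OPT_def)
  moreover have "total_size xs B \<le> OPT xs"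
    if "B \<subseteq> {..<length xs}" "total_size xs B \<le> 1" for B
    unfolding OPT_def using that by (intro Max_ge[OF fin]) auto
  ultimately show ?thesis using that by blast
qed

text \<open>Breaking ties by arrival gives a strict total order on the items, so the smallest items
  of a class are unambiguous even among equal sizes.\<close>

definition precedes :: "(nat \<Rightarrow> real) \<Rightarrow> nat \<Rightarrow> nat \<Rightarrow> bool" where
  "precedes x j i \<longleftrightarrow> x j < x i \<or> x j = x i \<and> j < i"

text \<open>Among all sets with the class multiset of \<open>A\<close> and no larger total, take one
  with the least sum of ranks \<open>r\<close>. If it contained \<open>i\<close> but missed a
  predecessor \<open>j\<close> of the same class, swapping \<open>i\<close> for \<open>j\<close>
  would give another such set with a smaller rank sum.\<close>

lemma exists_precedes_closed:
  fixes x :: "nat \<Rightarrow> real" and cls :: "nat \<Rightarrow> nat"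
  assumes fin: "finite S" and A: "A \<subseteq> S"
  obtains F where "F \<subseteq> S" "image_mset cls (mset_set F) = image_mset cls (mset_set A)"
    "sum x F \<le> sum x A"
    "\<And>i j. i \<in> F \<Longrightarrow> j \<in> S \<Longrightarrow> cls j = cls i \<Longrightarrow> precedes x j i \<Longrightarrow> j \<in> F"
proof -
  define r where "r i = card {j \<in> S. precedes x j i}" for i
  have r: "r j < r i" if "j \<in> S" "precedes x j i" for i j
    unfolding r_def
    by (rule psubset_card_mono) (use fin that in \<open>auto simp: precedes_def\<close>)
  define Q where "Q G \<longleftrightarrow> G \<subseteq> S \<and> image_mset cls (mset_set G) = image_mset cls (mset_set A)
    \<and> sum x G \<le> sum x A" for G
  have "Q A" using A by (simp add: Q_def)
  then obtain F where F: "Q F" "\<And>G. Q G \<Longrightarrow> sum r F \<le> sum r G"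
    using ex_has_least_nat[of Q A "sum r"] by blast
  have "j \<in> F" if ij: "i \<in> F" "j \<in> S" "cls j = cls i" "precedes x j i" for i j
  proof (rule ccontr)
    assume j: "j \<notin> F"
    let ?H = "F - {i}"
    have finF: "finite F" using F(1) fin finite_subset by (auto simp: Q_def)
    have F_eq: "F = insert i ?H" and jH: "j \<notin> ?H" and fH: "finite ?H"
      using ij j finF by auto
    have m: "mset_set F = add_mset i (mset_set ?H)"
      using F_eq fH mset_set.insert[of ?H i] by simp
    have s: "sum f F = f i + sum f ?H" for f :: "nat \<Rightarrow> 'z::comm_monoid_add"
      using F_eq fH sum.insert[of ?H i f] by simp
    have "x j \<le> x i" using ij by (auto simp: precedes_def)
    then have "Q (insert j ?H)"
      using F(1) ij jH fH s[of x] m by (auto simp: Q_def)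
    then have "sum r F \<le> sum r (insert j ?H)" by (rule F(2))
    then show False using s[of r] jH fH r[OF ij(2,4)] by simp
  qed
  then show ?thesis using F(1) that unfolding Q_def by blast
qed

text \<open>For positive sizes, class \<open>k\<close> is the interval from
  \<open>(k - 1) * w\<close> (exclusive) to \<open>k * w\<close> (inclusive). Hence
  \<open>w * size_class w x\<close> is the size rounded up to the top of its class.\<close>

definition size_class :: "real \<Rightarrow> real \<Rightarrow> nat" where
  "size_class w x = nat \<lceil>x / w\<rceil>"

lemma size_class_bounds:
  assumes "w > 0" "x > 0"
  shows "x \<le> w * size_class w x" "w * size_class w x \<le> x + w"
proof -
  have c: "real (size_class w x) = of_int \<lceil>x / w\<rceil>"
    using assms by (simp add: size_class_def)
  have "x / w \<le> of_int \<lceil>x / w\<rceil>" by linarith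
  then have "w * (x / w) \<le> w * of_int \<lceil>x / w\<rceil>" using assms by (intro mult_left_mono) simp_all
  then show "x \<le> w * size_class w x" using assms by (simp add: c)
  have "of_int \<lceil>x / w\<rceil> \<le> x / w + 1" by linarith
  then have "w * of_int \<lceil>x / w\<rceil> \<le> w * (x / w + 1)" using assms by (intro mult_left_mono) simp_all
  then show "w * size_class w x \<le> x + w" using assms by (simp add: c distrib_left)
qed

section \<open>Filling slots with the smallest revealed items\<close>

definition class_rank :: "real \<Rightarrow> real \<Rightarrow> real list \<Rightarrow> nat \<Rightarrow> nat" where
  "class_rank w \<tau> xs i = card {j. j < length xs \<and> \<tau> < xs ! j \<and>
     size_class w (xs ! j) = size_class w (xs ! i) \<and> precedes ((!) xs) j i}"

text \<open>Ranks start at \<open>0\<close>, so the multiplicity of a class in \<open>ks\<close> is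
  the quota of smallest items taken from it. The order of \<open>ks\<close> has no influence here;
  it matters only when prefixes of \<open>ks\<close> are taken.\<close>

definition smallest :: "real \<Rightarrow> real \<Rightarrow> nat list \<Rightarrow> real list \<Rightarrow> nat set" where
  "smallest w \<tau> ks xs = {i. i < length xs \<and> \<tau> < xs ! i \<and>
     class_rank w \<tau> xs i < count_list ks (size_class w (xs ! i))}"

lemma count_list_map_filter_upt:
  "count_list (map f (filter (\<lambda>i. i \<in> F) [0..<t])) k = card {i \<in> F. i < t \<and> f i = k}"
proof -
  have "count_list (map f (filter (\<lambda>i. i \<in> F) [0..<t])) k
      = length (filter (\<lambda>i. i \<in> F \<and> f i = k) [0..<t])"
    by (induction t) auto
  also have "\<dots> = card (set (filter (\<lambda>i. i \<in> F \<and> f i = k) [0..<t]))"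
    by (rule distinct_card[symmetric]) simp
  also have "set (filter (\<lambda>i. i \<in> F \<and> f i = k) [0..<t]) = {i \<in> F. i < t \<and> f i = k}" by auto
  finally show ?thesis .
qed

text \<open>Within each class, the revealed items of \<open>F\<close> form an initial segment of the
  order \<open>precedes\<close>, and the quota is exactly the size of that segment. A member of
  \<open>F\<close> has all its predecessors in the segment and counts there itself, so its rank is
  below the quota. A large non-member comes after the whole segment, so its rank reaches the
  quota.\<close>

lemma smallest_take_eq:
  assumes F: "F \<subseteq> {i. i < length xs \<and> \<tau> < xs ! i}"
    and closed: "\<And>i j. i \<in> F \<Longrightarrow> j < length xs \<Longrightarrow> \<tau> < xs ! j \<Longrightarrow>
       size_class w (xs ! j) = size_class w (xs ! i) \<Longrightarrow> precedes ((!) xs) j i \<Longrightarrow> j \<in> F"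
    and t: "t \<le> length xs"
  shows "smallest w \<tau> (map (\<lambda>i. size_class w (xs ! i)) (filter (\<lambda>i. i \<in> F) [0..<t])) (take t xs)
       = F \<inter> {..<t}"
proof -
  define cls where "cls i = size_class w (xs ! i)" for i
  define pre where "pre i = {j. j < t \<and> \<tau> < xs ! j \<and> cls j = cls i \<and> precedes ((!) xs) j i}" for i
  define same where "same i = {j \<in> F. j < t \<and> cls j = cls i}" for i
  have rank: "class_rank w \<tau> (take t xs) i = card (pre i)" if "i < t" for i
    unfolding class_rank_def pre_def cls_def using that t
    by (intro arg_cong[where f = card]) (auto simp: precedes_def)
  have fin: "finite (pre i)" "finite (same i)" for i by (simp_all add: pre_def same_def)
  have in_F: "card (pre i) < card (same i)" if "i \<in> F" "i < t" for i
  proof -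
    have "pre i \<subseteq> same i" using that closed t by (auto simp: pre_def same_def cls_def)
    moreover have "i \<in> same i" "i \<notin> pre i" using that by (auto simp: pre_def same_def precedes_def)
    ultimately show ?thesis using fin by (metis psubsetI psubset_card_mono)
  qed
  have not_in_F: "card (same i) \<le> card (pre i)" if "i \<notin> F" "i < t" "\<tau> < xs ! i" for i
  proof (rule card_mono[OF fin(1)])
    show "same i \<subseteq> pre i"
    proof
      fix j assume j: "j \<in> same i"
      then have "j \<noteq> i" "j \<in> F" using that by (auto simp: same_def)
      then have "\<not> precedes ((!) xs) i j"
        using closed[of j i] that t j by (auto simp: same_def cls_def)
      then have "precedes ((!) xs) j i" using \<open>j \<noteq> i\<close> by (auto simp: precedes_def)
      then show "j \<in> pre i" using j F by (auto simp: pre_def same_def)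
    qed
  qed
  have "i \<in> smallest w \<tau> (map cls (filter (\<lambda>i. i \<in> F) [0..<t])) (take t xs) \<longleftrightarrow>
      i < t \<and> \<tau> < xs ! i \<and> card (pre i) < card (same i)" for i
    using t rank[of i] by (auto simp: smallest_def count_list_map_filter_upt same_def
        simp flip: cls_def)
  moreover have "i < t \<and> \<tau> < xs ! i \<and> card (pre i) < card (same i) \<longleftrightarrow> i \<in> F \<inter> {..<t}" for i
    using F in_F[of i] not_in_F[of i] by (auto simp: not_less[symmetric])
  ultimately show ?thesis unfolding cls_def by blast
qed

section \<open>Online strategies: slots for large items, greedy packing of small ones\<close>

text \<open>
  A strategy \<open>(\<tau>, ks, l)\<close> treats items of size at most \<open>\<tau>\<close> as small, gives the large items the
  slots \<open>ks\<close> (listed by class, in order of priority) and reserves capacity \<open>l\<close> for them.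
\<close>

definition prefix_length :: "real \<Rightarrow> real \<times> nat list \<times> real \<Rightarrow> real list \<Rightarrow> nat" where
  "prefix_length w = (\<lambda>(\<tau>, ks, l) xs.
     GREATEST j. j \<le> length ks \<and> total_size xs (smallest w \<tau> (take j ks) xs) \<le> l)"

definition wanted :: "real \<Rightarrow> real \<times> nat list \<times> real \<Rightarrow> real list \<Rightarrow> nat set" where
  "wanted w = (\<lambda>(\<tau>, ks, l) xs. smallest w \<tau> (take (prefix_length w (\<tau>, ks, l) xs) ks) xs)"

text \<open>A wanted item can cease to be wanted and become wanted again once smaller items free
  capacity. Requiring it to be wanted at all times since its arrival keeps a discarded item out for
  good.\<close>

definition large_packing :: "real \<Rightarrow> real \<times> nat list \<times> real \<Rightarrow> real list \<Rightarrow> nat set" where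
  "large_packing w c xs =
     {i. i < length xs \<and> (\<forall>t. i < t \<and> t \<le> length xs \<longrightarrow> i \<in> wanted w c (take t xs))}"

primrec greedy :: "real \<Rightarrow> real \<Rightarrow> real list \<Rightarrow> nat \<Rightarrow> nat set" where
  "greedy \<tau> C xs 0 = {}"
| "greedy \<tau> C xs (Suc i) = greedy \<tau> C xs i \<union>
     (if xs ! i \<le> \<tau> \<and> total_size xs (greedy \<tau> C xs i) + xs ! i \<le> C then {i} else {})"

definition combined_packing :: "real \<Rightarrow> real \<times> nat list \<times> real \<Rightarrow> real list \<Rightarrow> nat set" where
  "combined_packing w c xs =
     large_packing w c xs \<union> greedy (fst c) (1 - snd (snd c)) xs (length xs)"

text \<open>The empty prefix fits since \<open>l \<ge> 0\<close>, so the greatest fitting prefix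
  exists. A longer prefix has at least the same quota for every class, so the greatest one covers
  what any fitting prefix selects.\<close>

lemma wanted_greatest:
  assumes "l \<ge> 0"
  shows "total_size xs (wanted w (\<tau>, ks, l) xs) \<le> l"
    and "j \<le> length ks \<Longrightarrow> total_size xs (smallest w \<tau> (take j ks) xs) \<le> l \<Longrightarrow>
      smallest w \<tau> (take j ks) xs \<subseteq> wanted w (\<tau>, ks, l) xs"
proof -
  let ?Q = "\<lambda>j. j \<le> length ks \<and> total_size xs (smallest w \<tau> (take j ks) xs) \<le> l"
  have 0: "?Q 0" using assms by (simp add: smallest_def total_size_def)
  have "?Q (Greatest ?Q)" by (rule GreatestI_nat[of ?Q, OF 0, of "length ks"]) simp
  then show "total_size xs (wanted w (\<tau>, ks, l) xs) \<le> l"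
    by (simp add: wanted_def prefix_length_def)
  assume "j \<le> length ks" "total_size xs (smallest w \<tau> (take j ks) xs) \<le> l"
  then have "j \<le> Greatest ?Q" by (intro Greatest_le_nat[of ?Q j "length ks"]) simp_all
  then have "take (Greatest ?Q) ks = take j ks @ take (Greatest ?Q - j) (drop j ks)"
    using take_add[of j "Greatest ?Q - j" ks] by simp
  then have "count_list (take j ks) k \<le> count_list (take (Greatest ?Q) ks) k" for k by simp
  then show "smallest w \<tau> (take j ks) xs \<subseteq> wanted w (\<tau>, ks, l) xs"
    unfolding wanted_def prefix_length_def smallest_def
    by (auto intro: less_le_trans)
qed

lemma wanted_large: "wanted w c xs \<subseteq> {i. i < length xs \<and> fst c < xs ! i}"
  by (auto simp: wanted_def smallest_def split: prod.splits)

lemma large_packing_wanted: "large_packing w c xs \<subseteq> wanted w c xs"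
  by (auto simp: large_packing_def)

lemma greedy_subset: "greedy \<tau> C xs n \<subseteq> {i. i < n \<and> xs ! i \<le> \<tau>}"
  by (induction n) (auto split: if_splits)

lemma finite_greedy [simp]: "finite (greedy \<tau> C xs n)"
  by (rule finite_subset[OF greedy_subset]) simp

lemma total_size_greedy_Suc:
  "total_size xs (greedy \<tau> C xs (Suc n)) = total_size xs (greedy \<tau> C xs n) +
     (if xs ! n \<le> \<tau> \<and> total_size xs (greedy \<tau> C xs n) + xs ! n \<le> C then xs ! n else 0)"
proof -
  have "n \<notin> greedy \<tau> C xs n" using greedy_subset[of \<tau> C xs n] by auto
  then show ?thesis by (simp add: total_size_def)
qed

lemma greedy_fits: "C \<ge> 0 \<Longrightarrow> total_size xs (greedy \<tau> C xs n) \<le> C"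
proof (induction n)
  case (Suc n)
  then show ?case unfolding total_size_greedy_Suc by simp
qed (simp add: total_size_def)

lemma greedy_take: "n \<le> m \<Longrightarrow> greedy \<tau> C (take m xs) n = greedy \<tau> C xs n"
proof (induction n)
  case (Suc n)
  have "total_size (take m xs) (greedy \<tau> C xs n) = total_size xs (greedy \<tau> C xs n)"
    unfolding total_size_def using greedy_subset[of \<tau> C xs n] Suc.prems
    by (intro sum.cong) auto
  then show ?case using Suc by simp
qed simp

text \<open>The greedy total never decreases, so an item of size at most \<open>\<tau>\<close> that
  was rejected on arrival would still overflow \<open>C\<close> at the end. Thus greedy either takes
  all such items or ends with a total above \<open>C - \<tau>\<close>.\<close>

lemma greedy_alternative:
  assumes "\<And>i. i < n \<Longrightarrow> xs ! i > 0"
  shows "greedy \<tau> C xs n = {i. i < n \<and> xs ! i \<le> \<tau>} \<or>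
    (\<exists>i<n. xs ! i \<le> \<tau> \<and> total_size xs (greedy \<tau> C xs n) + xs ! i > C)"
  using assms
proof (induction n)
  case (Suc n)
  have ge: "total_size xs (greedy \<tau> C xs n) \<le> total_size xs (greedy \<tau> C xs (Suc n))"
    unfolding total_size_greedy_Suc using Suc.prems[of n] by simp
  consider "greedy \<tau> C xs n = {i. i < n \<and> xs ! i \<le> \<tau>}"
    | i where "i < n" "xs ! i \<le> \<tau>" "total_size xs (greedy \<tau> C xs n) + xs ! i > C"
    using Suc by force
  then show ?case
  proof cases
    case 1
    show ?thesis
    proof (cases "xs ! n \<le> \<tau> \<and> total_size xs (greedy \<tau> C xs n) + xs ! n > C")
      case True
      then show ?thesis using ge by (intro disjI2 exI[of _ n]) simp
    next
      case False
      then show ?thesis using 1 by (auto simp: less_Suc_eq)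
    qed
  next
    case 2
    then show ?thesis using ge by (intro disjI2 exI[of _ i]) simp
  qed
qed simp

section \<open>The combined packing and its feasibility\<close>

lemma combined_packing_subset: "combined_packing w c xs \<subseteq> {..<length xs}"
  using greedy_subset[of "fst c" "1 - snd (snd c)" xs "length xs"]
  by (auto simp: combined_packing_def large_packing_def)

lemma total_size_combined_packing:
  "total_size xs (combined_packing w c xs) =
     total_size xs (large_packing w c xs) +
     total_size xs (greedy (fst c) (1 - snd (snd c)) xs (length xs))"
  unfolding combined_packing_def total_size_def
proof (rule sum.union_disjoint)
  show "finite (large_packing w c xs)" by (simp add: large_packing_def)
  show "large_packing w c xs \<inter> greedy (fst c) (1 - snd (snd c)) xs (length xs) = {}"
    using large_packing_wanted[of w c xs] wanted_large[of w c xs]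
      greedy_subset[of "fst c" "1 - snd (snd c)" xs "length xs"] by force
qed simp

text \<open>A further round only adds a condition on the large items already present, and greedy
  decisions never depend on later items.\<close>

lemma combined_packing_step:
  assumes "i < length xs"
  shows "combined_packing w c (take (Suc i) xs) \<subseteq> combined_packing w c (take i xs) \<union> {i}"
proof -
  have len: "length (take (Suc i) xs) = Suc i" "length (take i xs) = i" using assms by simp_all
  have "large_packing w c (take (Suc i) xs) \<subseteq> large_packing w c (take i xs) \<union> {i}"
    unfolding large_packing_def len by (auto simp: min_absorb1 less_Suc_eq)
  then show ?thesis
    unfolding combined_packing_def len by (auto simp: greedy_take simp del: take_Suc_conv_app_nth)
qed

lemma total_size_mono:
  assumes "remknap_instance xs" "A \<subseteq> B" "B \<subseteq> {..<length xs}"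
  shows "total_size xs A \<le> total_size xs B"
  unfolding total_size_def
proof (rule sum_mono2)
  show "finite B" using assms(3) finite_subset by blast
  show "0 \<le> xs ! i" if "i \<in> B - A" for i
    using assms that by (fastforce simp: remknap_instance_def intro: less_imp_le)
qed fact

text \<open>The strategy \<open>(1, [], 0)\<close> is plain greedy with the whole capacity, meant
  for small optima. In the others, the reserve is computed from \<open>ks\<close> as the total of
  the class tops, capped at the capacity. So no real number needs to be communicated, and the set is
  finite.\<close>

definition strategies :: "nat \<Rightarrow> (real \<times> nat list \<times> real) set" where
  "strategies q = insert (1, [], 0)
     ((\<lambda>ks. (1 / real q, ks, min 1 (1 / real (q ^ 2) * real (sum_list ks)))) `
       {ks. set ks \<subseteq> {..q ^ 2} \<and> length ks \<le> q})"

lemma finite_strategies: "finite (strategies q)"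
  unfolding strategies_def by (intro finite.insertI finite_imageI finite_lists_length_le) simp

lemma strategies_bounds:
  assumes "(\<tau>, ks, l) \<in> strategies q"
  shows "0 \<le> \<tau>" "0 \<le> l" "l \<le> 1"
  using assms by (auto simp: strategies_def)

lemma combined_packing_fits:
  assumes "c \<in> strategies q"
  shows "total_size xs (combined_packing w c xs) \<le> 1"
proof -
  obtain \<tau> ks l where c: "c = (\<tau>, ks, l)" by (cases c)
  note b = strategies_bounds[OF assms[unfolded c]]
  have "total_size xs (large_packing w c xs) \<le> total_size xs (wanted w c xs)"
    unfolding total_size_def
  proof (rule sum_mono2)
    show "finite (wanted w c xs)" by (rule finite_subset[OF wanted_large]) simp
    show "0 \<le> xs ! i" if "i \<in> wanted w c xs - large_packing w c xs" for i
      using that wanted_large[of w c xs] b by (fastforce simp: c)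
  qed (rule large_packing_wanted)
  also have "\<dots> \<le> l" using wanted_greatest(1) b by (simp add: c)
  finally show ?thesis
    using greedy_fits[of "1 - l" xs \<tau> "length xs"] b
    by (simp add: total_size_combined_packing c)
qed

section \<open>Quality of the packings\<close>

text \<open>Both the greedy total and every single item of size at most \<open>1\<close> are
  feasible packings, hence below \<open>1 / 2\<close>. So no such item is ever rejected, and greedy
  packs everything an optimal packing could use.\<close>

lemma greedy_optimal_if_OPT_small:
  assumes inst: "remknap_instance xs" and small: "OPT xs < 1 / 2"
  shows "OPT xs \<le> total_size xs (greedy 1 1 xs (length xs))"
proof -
  let ?G = "greedy 1 1 xs (length xs)"
  have pos: "xs ! i > 0" if "i < length xs" for i
    using inst that by (simp add: remknap_instance_def)
  obtain A where A: "A \<subseteq> {..<length xs}" "total_size xs A \<le> 1" "OPT xs = total_size xs A"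
    and opt: "\<And>B. B \<subseteq> {..<length xs} \<Longrightarrow> total_size xs B \<le> 1 \<Longrightarrow> total_size xs B \<le> OPT xs"
    by (rule OPT_attained[of xs]) blast
  have G: "?G \<subseteq> {..<length xs}" using greedy_subset[of 1 1 xs "length xs"] by auto
  have "total_size xs ?G \<le> OPT xs" by (intro opt G greedy_fits) simp
  moreover have "xs ! i \<le> OPT xs" if "i < length xs" "xs ! i \<le> 1" for i
    using opt[of "{i}"] that by (simp add: total_size_def)
  ultimately have "\<not> (\<exists>i<length xs. xs ! i \<le> 1 \<and> total_size xs ?G + xs ! i > 1)"
    using small by fastforce
  then have G_eq: "?G = {i. i < length xs \<and> xs ! i \<le> 1}"
    using greedy_alternative[of "length xs" xs 1 1] pos by blast
  have "A \<subseteq> ?G"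
  proof
    fix i assume "i \<in> A"
    then have "total_size xs {i} \<le> total_size xs A"
      using total_size_mono[OF inst, of "{i}" A] A by auto
    then show "i \<in> ?G" using A \<open>i \<in> A\<close> unfolding G_eq by (auto simp: total_size_def)
  qed
  then show ?thesis using total_size_mono[OF inst _ G] A by simp
qed

text \<open>
  As \<open>F\<close> is closed under predecessors within a class, its items revealed by time \<open>t\<close> are the
  smallest ones of their classes at that time, so they fill exactly the first slots.
\<close>

lemma large_packing_superset:
  assumes F: "F \<subseteq> {i. i < length xs \<and> \<tau> < xs ! i}"
    and closed: "\<And>i j. i \<in> F \<Longrightarrow> j < length xs \<Longrightarrow> \<tau> < xs ! j \<Longrightarrow>
       size_class w (xs ! j) = size_class w (xs ! i) \<Longrightarrow> precedes ((!) xs) j i \<Longrightarrow> j \<in> F"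
    and inst: "remknap_instance xs"
    and l: "total_size xs F \<le> l" "l \<ge> 0"
  shows "F \<subseteq> large_packing w
    (\<tau>, map (\<lambda>i. size_class w (xs ! i)) (filter (\<lambda>i. i \<in> F) [0..<length xs]), l) xs"
proof -
  define part where
    "part t = map (\<lambda>i. size_class w (xs ! i)) (filter (\<lambda>i. i \<in> F) [0..<t])" for t
  have "i \<in> wanted w (\<tau>, part (length xs), l) (take t xs)"
    if "i \<in> F" "i < t" "t \<le> length xs" for i t
  proof -
    have "[0..<length xs] = [0..<t] @ [t..<length xs]"
      using that upt_add_eq_append[of 0 t "length xs - t"] by simp
    then have "part (length xs) = part t @ map (\<lambda>i. size_class w (xs ! i))
        (filter (\<lambda>i. i \<in> F) [t..<length xs])" by (simp add: part_def)
    then have take: "take (length (part t)) (part (length xs)) = part t"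
      and len: "length (part t) \<le> length (part (length xs))" by simp_all
    have eq: "smallest w \<tau> (part t) (take t xs) = F \<inter> {..<t}"
      unfolding part_def by (rule smallest_take_eq[OF F closed that(3)])
    have "total_size (take t xs) (F \<inter> {..<t}) = total_size xs (F \<inter> {..<t})"
      by (simp add: total_size_def)
    also have "\<dots> \<le> total_size xs F" using F by (intro total_size_mono[OF inst]) auto
    \<comment> \<open>The slots belonging to the items of \<open>F\<close> revealed so far form a
      prefix that fits into \<open>l\<close>, so the longest fitting prefix covers them.\<close>
    finally have "F \<inter> {..<t} \<subseteq> wanted w (\<tau>, part (length xs), l) (take t xs)"
      using wanted_greatest(2)[OF l(2) len, of "take t xs" w \<tau>] l(1) by (simp add: take eq)
    then show ?thesis using that by auto
  qed
  then show ?thesis using F by (auto simp: large_packing_def part_def)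
qed

lemma near_optimal_strategy:
  assumes inst: "remknap_instance xs" and q: "q > 0"
  shows "\<exists>c\<in>strategies q.
    OPT xs - 3 / real q \<le> total_size xs (combined_packing (1 / real (q ^ 2)) c xs)"
proof -
  define \<delta> where "\<delta> = 1 / real q"
  define w where "w = 1 / real (q ^ 2)"
  define cls where "cls i = size_class w (xs ! i)" for i
  have pos: "xs ! i > 0" if "i < length xs" for i
    using inst that by (simp add: remknap_instance_def)
  have \<delta>: "\<delta> > 0" and w: "w > 0" and qw: "real q * w = \<delta>" and q\<delta>: "real q * \<delta> = 1"
    using q by (simp_all add: \<delta>_def w_def power2_eq_square)
  obtain A where A: "A \<subseteq> {..<length xs}" "total_size xs A \<le> 1" "OPT xs = total_size xs A"
    by (rule OPT_attained[of xs]) blast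
  define S where "S = {i. i < length xs \<and> \<delta> < xs ! i}"
  define AL where "AL = A \<inter> S"
  define AS where "AS = A - S"
  have finS: "finite S" and AL: "AL \<subseteq> S" and finAL: "finite AL"
    by (auto simp: S_def AL_def)
  have A_split: "total_size xs A = total_size xs AL + total_size xs AS"
    unfolding total_size_def AL_def AS_def using finite_subset[OF A(1)]
    by (simp add: sum.Int_Diff)
  have AS_nonneg: "total_size xs AS \<ge> 0"
    unfolding total_size_def AS_def using A pos by (intro sum_nonneg) (auto intro!: less_imp_le)
  have AL_le: "total_size xs AL \<le> 1" using A_split AS_nonneg A by simp
  obtain F where FS: "F \<subseteq> S" and mset: "image_mset cls (mset_set F) = image_mset cls (mset_set AL)"
    and F_le: "sum ((!) xs) F \<le> sum ((!) xs) AL"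
    and closed: "\<And>i j. i \<in> F \<Longrightarrow> j \<in> S \<Longrightarrow> cls j = cls i \<Longrightarrow> precedes ((!) xs) j i \<Longrightarrow> j \<in> F"
    using exists_precedes_closed[OF finS AL, where x = "(!) xs" and cls = cls] by blast
  have finF: "finite F" using FS finS finite_subset by blast
  have card_eq: "card F = card AL"
    using arg_cong[OF mset, of size] by simp
  \<comment> \<open>Each large item exceeds \<open>\<delta>\<close>, so at most \<open>q\<close> of
    them fit into the capacity.\<close>
  have "card AL * \<delta> \<le> total_size xs AL"
    unfolding total_size_def using AL by (intro sum_bounded_below) (auto simp: S_def)
  then have "real (card AL) * \<delta> \<le> real q * \<delta>" using AL_le q\<delta> by simp
  then have card_le: "card F \<le> q" using \<delta> by (simp add: card_eq)
  have card_w: "real (card F) * w \<le> \<delta>"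
    using mult_right_mono[of "real (card F)" "real q" w] card_le w qw by simp
  have cls_sum: "sum cls F = sum cls AL"
    using arg_cong[OF mset, of sum_mset] by (simp add: sum_unfold_sum_mset)
  have bounds: "sum ((!) xs) B \<le> w * sum cls B" "w * sum cls B \<le> sum ((!) xs) B + card B * w"
    if "B \<subseteq> S" for B
  proof -
    have b: "xs ! i \<le> w * cls i" "w * cls i \<le> xs ! i + w" if "i \<in> B" for i
      using size_class_bounds[OF w pos[of i]] \<open>B \<subseteq> S\<close> that by (auto simp: S_def cls_def)
    show "sum ((!) xs) B \<le> w * sum cls B"
      by (simp add: sum_distrib_left b sum_mono)
    have "w * sum cls B \<le> (\<Sum>i\<in>B. xs ! i + w)" by (simp add: sum_distrib_left b sum_mono)
    then show "w * sum cls B \<le> sum ((!) xs) B + card B * w" by (simp add: sum.distrib)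
  qed
  \<comment> \<open>\<open>U\<close> is the total of \<open>F\<close> with sizes rounded up to class
    tops; \<open>AL\<close> has the same rounded total. Rounding adds at most \<open>w\<close> per
    item, and at most \<open>q * w = \<delta>\<close> overall.\<close>
  define U where "U = w * sum cls F"
  have U: "total_size xs F \<le> U" "U \<le> total_size xs F + \<delta>" "total_size xs AL \<le> U"
    using bounds[OF FS] bounds[OF AL] card_w by (simp_all add: U_def total_size_def cls_sum)
  define ks where "ks = map cls (filter (\<lambda>i. i \<in> F) [0..<length xs])"
  have F_set: "set (filter (\<lambda>i. i \<in> F) [0..<length xs]) = F" using FS by (auto simp: S_def)
  have len_ks: "length ks = card F"
    using distinct_card[of "filter (\<lambda>i. i \<in> F) [0..<length xs]"] F_set by (simp add: ks_def)
  have sum_ks: "sum_list ks = sum cls F"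
    unfolding ks_def using F_set by (subst sum_list_distinct_conv_sum_set) auto
  have "cls i \<le> q ^ 2" if "i \<in> F" for i
  proof -
    have "xs ! i \<le> sum ((!) xs) F"
      using member_le_sum[of i F "(!) xs"] that finF FS pos
      by (fastforce simp: S_def intro: less_imp_le)
    then have "xs ! i \<le> 1" using F_le AL_le by (simp add: total_size_def)
    then have "xs ! i / w \<le> of_int (int (q ^ 2))"
      using q by (simp add: w_def field_simps)
    then have "\<lceil>xs ! i / w\<rceil> \<le> int (q ^ 2)" by (rule ceiling_le)
    then show ?thesis by (simp add: cls_def size_class_def nat_le_iff)
  qed
  then have ks: "set ks \<subseteq> {..q ^ 2}" using F_set by (auto simp: ks_def)
  \<comment> \<open>Rounding up may exceed the capacity, hence the cap; \<open>F\<close> still fits,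
    as its total is at most that of \<open>AL\<close>.\<close>
  define l where "l = min 1 U"
  have l: "total_size xs F \<le> l" "0 \<le> l" "l \<le> 1"
    using U(1) F_le AL_le w by (auto simp: l_def U_def total_size_def intro!: mult_nonneg_nonneg sum_nonneg)
  define c where "c = (\<delta>, ks, l)"
  have c: "c \<in> strategies q"
    unfolding strategies_def c_def using ks len_ks card_le
    by (intro insertI2 image_eqI[of _ _ ks]) (simp_all add: \<delta>_def l_def U_def w_def sum_ks)
  have F_packed: "F \<subseteq> large_packing w c xs"
    unfolding c_def ks_def cls_def
    by (rule large_packing_superset)
      (use FS closed inst l in \<open>auto simp: S_def cls_def\<close>)
  have F_total: "total_size xs F \<le> total_size xs (large_packing w c xs)"
    using F_packed by (intro total_size_mono[OF inst]) (auto simp: large_packing_def)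
  let ?G = "greedy \<delta> (1 - l) xs (length xs)"
  have "total_size xs AS - 2 * \<delta> \<le> total_size xs ?G"
  proof -
    consider "?G = {i. i < length xs \<and> xs ! i \<le> \<delta>}" | "total_size xs ?G + \<delta> > 1 - l"
      using greedy_alternative[of "length xs" xs \<delta> "1 - l"] pos by fastforce
    then show ?thesis
    proof cases
      case 1
      then have "AS \<subseteq> ?G" using A by (auto simp: AS_def S_def)
      then have "total_size xs AS \<le> total_size xs ?G"
        using greedy_subset[of \<delta> "1 - l" xs "length xs"]
        by (intro total_size_mono[OF inst]) auto
      then show ?thesis using \<delta> by simp
    next
      case 2
      \<comment> \<open>Since \<open>l \<le> U \<le> total_size xs AL + \<delta>\<close>, the
        unreserved capacity falls short of what \<open>AS\<close> needs by at most
        \<open>\<delta>\<close>.\<close>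
      have "1 - l \<ge> total_size xs AS - \<delta>"
        using A_split A(2) U F_le by (simp add: l_def total_size_def)
      then show ?thesis using 2 by simp
    qed
  qed
  moreover have "total_size xs AL - \<delta> \<le> total_size xs F" using U by simp
  ultimately have "OPT xs - 3 * \<delta> \<le> total_size xs (combined_packing w c xs)"
    using F_total A(3) A_split by (simp add: total_size_combined_packing c_def)
  then show ?thesis using c by (auto simp: \<delta>_def w_def)
qed

theorem theorem8:
  fixes \<epsilon> :: real
  assumes "\<epsilon> > 0"
  shows "\<exists>(c :: nat) (alg :: advice_algorithm) (oracle_tape :: real list \<Rightarrow> tape).
           remknap_algorithm alg \<and>
           (\<forall>xs. remknap_instance xs \<longrightarrow> bits_read alg (oracle_tape xs) xs \<le> c) \<and>
           strictly_competitive (1 + \<epsilon>) alg oracle_tape"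
proof -
  \<comment> \<open>The bound on \<open>q\<close> makes the loss \<open>3 / q\<close>, scaled by
    \<open>1 + \<epsilon>\<close>, at most \<open>\<epsilon> / 2\<close>. This is affordable once
    \<open>OPT xs \<ge> 1 / 2\<close>, because then
    \<open>\<epsilon> * OPT xs \<ge> \<epsilon> / 2\<close>.\<close>
  obtain q :: nat where q: "6 * (1 + \<epsilon>) / \<epsilon> < real q" using reals_Archimedean2 by blast
  have "0 < 6 * (1 + \<epsilon>) / \<epsilon>" using assms by simp
  then have q0: "q > 0" using q by (cases q) auto
  have loss: "(1 + \<epsilon>) * (3 / real q) \<le> \<epsilon> / 2"
    using q q0 assms by (simp add: field_simps)
  let ?P = "combined_packing (1 / real (q ^ 2))"
  show ?thesis
  proof (rule competitive_of_finitely_many_strategies[where K = "strategies q" and P = ?P])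
    show "strategies q \<noteq> {}" by (simp add: strategies_def)
    show "?P c [] = {}" for c using combined_packing_subset[of _ c "[]"] by simp
    fix xs :: "real list"
    assume inst: "remknap_instance xs"
    show "\<exists>c\<in>strategies q. OPT xs \<le> (1 + \<epsilon>) * total_size xs (?P c xs)"
    proof (cases "OPT xs < 1 / 2")
      case True
      have "large_packing (1 / real (q ^ 2)) (1, [], 0) xs = {}"
        using large_packing_wanted[of _ "(1, [], 0)" xs] by (auto simp: wanted_def smallest_def)
      then have le: "OPT xs \<le> total_size xs (?P (1, [], 0) xs)"
        using greedy_optimal_if_OPT_small[OF inst True]
        by (simp add: total_size_combined_packing)
      have "total_size xs {} \<le> total_size xs (?P (1, [], 0) xs)"
        by (intro total_size_mono[OF inst] combined_packing_subset) simp
      then have "0 \<le> \<epsilon> * total_size xs (?P (1, [], 0) xs)"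
        using assms by simp
      then have "OPT xs \<le> (1 + \<epsilon>) * total_size xs (?P (1, [], 0) xs)"
        using le by (simp add: distrib_right)
      then show ?thesis by (auto simp: strategies_def)
    next
      case False
      obtain c where c: "c \<in> strategies q" "OPT xs - 3 / real q \<le> total_size xs (?P c xs)"
        using near_optimal_strategy[OF inst q0] by blast
      have "\<epsilon> / 2 \<le> \<epsilon> * OPT xs"
        using False mult_left_mono[of "1 / 2" "OPT xs" \<epsilon>] assms by simp
      with loss have "OPT xs \<le> (1 + \<epsilon>) * OPT xs - (1 + \<epsilon>) * (3 / real q)"
        unfolding distrib_right by linarith
      also have "\<dots> = (1 + \<epsilon>) * (OPT xs - 3 / real q)" by (rule right_diff_distrib[symmetric])
      also have "\<dots> \<le> (1 + \<epsilon>) * total_size xs (?P c xs)"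
        using c assms by (intro mult_left_mono) simp_all
      finally show ?thesis using c by blast
    qed
  qed (use finite_strategies combined_packing_step combined_packing_fits combined_packing_subset
        in blast)+
qed

end
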